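(* Let $B$ be a solution of size $|B|$ and let $A_1,A_2,\dots,A_{|B|}$ be solutions, all of the same size $|A|$. Then the generalized composition $(A_1,A_2,\dots,A_{|B|})\otimes B$ is a solution if and only if both of the following conditions hold: 1. $\{B(i)-i \pmod{|B|} \mid 1\le i\le |B|\}=\mathbb{Z}_{|B|}$; 2. $\{B(i)+i \pmod{|B|} \mid 1\le i\le |B|\}=\mathbb{Z}_{|B|}$.
   Context: A solution of size $N$ (to the $N$-Queens Problem) is a permutation $A$ of $\{1,\dots,N\}$ such that $|i-j|\neq|A(i)-A(j)|$ for all $1\le i<j\le N$; its size is denoted $|A|=N$. Given a solution $B$ and solutions $A_1,\dots,A_{|B|}$ all of the same size, denoted $|A|$, the generalized composition $C=(A_1,\dots,A_{|B|})\otimes B$ is the arrangement of size $|A||B|$ defined by $$C(|B|(i-1)+j)=|B|(A_j(i)-1)+B(j),\qquad 1\le i\le |A|,\ 1\le j\le |B|.$$ $\mathbb{Z}_{|B|}$ denotes the ring of residues modulo $|B|$.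
   Formalization: The size |A| is assumed to be at least 2: for |A| = 1 the composition equals B and is always a solution, yet B = (2,4,1,3) violates condition 1 (and the empty size |A| = 0 fails likewise). *)

theory Defs
  imports "HOL-Number_Theory.Residues"
begin

text \<open>An arrangement of size \<open>N\<close> is a function on \<open>nat\<close> of which only the values on
  \<open>{1..N}\<close> matter.\<close>

definition queens_solution :: "nat \<Rightarrow> (nat \<Rightarrow> nat) \<Rightarrow> bool" where
  "queens_solution N A \<longleftrightarrow>
     bij_betw A {1..N} {1..N} \<and>
     (\<forall>i j. 1 \<le> i \<and> i < j \<and> j \<le> N \<longrightarrow> \<bar>int i - int j\<bar> \<noteq> \<bar>int (A i) - int (A j)\<bar>)"

text \<open>The argument \<open>n\<close> is the size of \<open>B\<close>. The position \<open>k = n * (i - 1) + j\<close> with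
  \<open>1 \<le> j \<le> n\<close> is decoded as \<open>i = (k - 1) div n + 1\<close> and \<open>j = (k - 1) mod n + 1\<close>;
  the lemma \<open>gen_comp_eq\<close> recovers the usual defining equation.\<close>

definition gen_comp :: "nat \<Rightarrow> (nat \<Rightarrow> nat \<Rightarrow> nat) \<Rightarrow> (nat \<Rightarrow> nat) \<Rightarrow> nat \<Rightarrow> nat" where
  "gen_comp n A B k =
     (let i = (k - 1) div n + 1; j = (k - 1) mod n + 1
      in n * (A j i - 1) + B j)"

lemma gen_comp_eq:
  assumes "1 \<le> i" and "1 \<le> j" and "j \<le> n"
  shows "gen_comp n A B (n * (i - 1) + j) = n * (A j i - 1) + B j"
proof -
  obtain a b where "i = Suc a" and "j = Suc b"
    using assms by (metis Suc_le_D One_nat_def)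
  then show ?thesis
    using assms by (simp add: gen_comp_def Let_def)
qed

end

theory Submission
  imports Defs
begin

text \<open>Call the two diagonals through the square \<open>(i, A i)\<close> the numbers \<open>A i - i\<close> and
  \<open>A i + i\<close>; a permutation is a solution iff both are injective in \<open>i\<close>. In block coordinates
  the composition sends the \<open>j\<close>-th position of block \<open>i\<close> to the \<open>B j\<close>-th value of block
  \<open>A j i\<close>, so its diagonals are \<open>n\<close> times a diagonal of \<open>A j\<close> plus the diagonal of \<open>B\<close>
  at \<open>j\<close>, up to a constant.

  If the diagonals of \<open>B\<close> are distinct modulo \<open>n\<close>, then two queens on a common diagonal
  of the composition have the same \<open>j\<close>, and they attack each other already in \<open>A j\<close>.
  Conversely, diagonals of \<open>B\<close> that agree modulo \<open>n\<close> but are distinct differ by exactly \<open>n\<close>,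
  because they differ by less than \<open>2 n\<close>. The composition then has two attacking queens as soon
  as some diagonal of \<open>A j\<close> is one less than some diagonal of \<open>A j'\<close>. This always
  happens for \<open>m \<ge> 2\<close> (lemma \<open>shifted_diagonals_meet\<close>), by a pigeonhole argument that is tight: the
  \<open>m\<close> shifted diagonals of the one solution and the \<open>m\<close> diagonals of the other lie in an
  interval of \<open>2 m\<close> integers, and if they were disjoint they would fill it, which forces queens
  into corners and next to corners where they cannot all be.

  Finally, \<open>n\<close> residues modulo \<open>n\<close> are distinct iff they are all of the residues.\<close>

section \<open>Diagonals of an arrangement\<close>

text \<open>The sign \<open>s\<close> ranges over \<open>{1, -1}\<close> and selects the direction of the diagonals, so that
  both directions are treated by one argument.\<close>

definition diagonal :: "int \<Rightarrow> (nat \<Rightarrow> nat) \<Rightarrow> nat \<Rightarrow> int" where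
  "diagonal s A i = int (A i) - s * int i"

lemma queens_solution_iff_inj_diagonals:
  "queens_solution N A \<longleftrightarrow>
     bij_betw A {1..N} {1..N} \<and> (\<forall>s\<in>{1, -1}. inj_on (diagonal s A) {1..N})"
proof -
  have "(\<forall>i j. 1 \<le> i \<and> i < j \<and> j \<le> N \<longrightarrow> \<bar>int i - int j\<bar> \<noteq> \<bar>int (A i) - int (A j)\<bar>) \<longleftrightarrow>
    (\<forall>s\<in>{1, -1}. inj_on (diagonal s A) {1..N})" (is "?L \<longleftrightarrow> ?R")
  proof
    assume L: ?L
    show ?R
    proof (intro ballI linorder_inj_onI')
      fix s :: int and i j
      assume "s \<in> {1, -1}" "i \<in> {1..N}" "j \<in> {1..N}" "i < j"
      moreover from this L have "\<bar>int i - int j\<bar> \<noteq> \<bar>int (A i) - int (A j)\<bar>" by auto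
      ultimately show "diagonal s A i \<noteq> diagonal s A j"
        unfolding abs_eq_iff diagonal_def by auto
    qed
  next
    assume R: ?R
    show ?L
    proof (intro allI impI)
      fix i j assume ij: "1 \<le> i \<and> i < j \<and> j \<le> N"
      have "diagonal s A i \<noteq> diagonal s A j" if "s \<in> {1, -1}" for s
        using inj_on_eq_iff[OF R[rule_format, OF that], of i j] ij by simp
      from this[of 1] this[of "-1"]
      have "int (A i) - int i \<noteq> int (A j) - int j" "int (A i) + int i \<noteq> int (A j) + int j"
        by (simp_all add: diagonal_def)
      then show "\<bar>int i - int j\<bar> \<noteq> \<bar>int (A i) - int (A j)\<bar>" by linarith
    qed
  qed
  then show ?thesis by (simp add: queens_solution_def)
qed

lemma queens_solution_range:
  assumes "queens_solution N A" "i \<in> {1..N}"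
  shows "A i \<in> {1..N}"
  using assms by (auto simp: queens_solution_def dest: bij_betwE)

section \<open>Shifted diagonals meet\<close>

text \<open>The mirror image exchanges the two directions of diagonals.\<close>

lemma queens_solution_mirror:
  assumes "queens_solution m A"
  shows "queens_solution m (\<lambda>i. m + 1 - A i)"
proof -
  have range: "A i \<in> {1..m}" if "i \<in> {1..m}" for i
    using assms that by (rule queens_solution_range)
  have "bij_betw (\<lambda>v. m + 1 - v) {1..m} {1..m}"
    by (rule bij_betwI[where g = "\<lambda>v. m + 1 - v"]) auto
  with assms have "bij_betw ((\<lambda>v. m + 1 - v) \<circ> A) {1..m} {1..m}"
    unfolding queens_solution_def by (blast intro: bij_betw_trans)
  moreover have "int (m + 1 - A i) - int (m + 1 - A j) = int (A j) - int (A i)"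
    if "i \<in> {1..m}" "j \<in> {1..m}" for i j
    using range[OF that(1)] range[OF that(2)] by auto
  ultimately show ?thesis
    using assms by (auto simp: queens_solution_def comp_def abs_minus_commute)
qed

text \<open>The shifted diagonals of \<open>A\<close> lie in \<open>{2 - m..m}\<close>, the diagonals of \<open>A'\<close> in
  \<open>{1 - m..m - 1}\<close>. If the two sets were disjoint, their \<open>2 m\<close> elements would fill
  \<open>{1 - m..m}\<close>. The ends of this interval can only come from a queen of \<open>A\<close> in the corner
  \<open>(1, m)\<close> and a queen of \<open>A'\<close> in the corner \<open>(m, 1)\<close>. Now \<open>2 - m\<close> has no possible source:
  in \<open>A\<close> it requires a queen at \<open>(m, 1)\<close>, which attacks \<open>(1, m)\<close>; in \<open>A'\<close> it requires a
  queen at \<open>(m, 2)\<close> or \<open>(m - 1, 1)\<close>, in the row or column of the corner queen.\<close>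

lemma shifted_main_diagonals_meet:
  assumes m: "2 \<le> m" and A: "queens_solution m A" and A': "queens_solution m A'"
  shows "\<exists>i\<in>{1..m}. \<exists>i'\<in>{1..m}. diagonal 1 A i + 1 = diagonal 1 A' i'"
proof (rule ccontr)
  assume contra: "\<not> ?thesis"
  define S where "S = (\<lambda>i. diagonal 1 A i + 1) ` {1..m}"
  define S' where "S' = diagonal 1 A' ` {1..m}"
  note range = queens_solution_range[OF A] queens_solution_range[OF A']
  have disj: "S \<inter> S' = {}" using contra by (auto simp: S_def S'_def)
  have "inj_on (diagonal 1 A) {1..m}"
    using A by (simp add: queens_solution_iff_inj_diagonals)
  then have "inj_on (\<lambda>i. diagonal 1 A i + 1) {1..m}"
    by (meson add_right_cancel inj_on_def)
  then have "card S = m" by (simp add: S_def card_image)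
  moreover have "card S' = m"
    using A' by (simp add: S'_def card_image queens_solution_iff_inj_diagonals)
  ultimately have card: "card (S \<union> S') = 2 * m"
    using disj by (subst card_Un_disjoint) (auto simp: S_def S'_def)
  have sub: "S \<union> S' \<subseteq> {1 - int m..int m}"
    using range by (force simp: S_def S'_def diagonal_def)
  have fill: "S \<union> S' = {1 - int m..int m}"
    by (rule card_subset_eq) (use sub card in auto)
  have "int m \<notin> S'"
    using range(2) by (force simp: S'_def diagonal_def)
  then have "int m \<in> S" using fill m by force
  then obtain i where i: "i \<in> {1..m}" "int (A i) - int i + 1 = int m"
    by (auto simp: S_def diagonal_def)
  then have corner: "A 1 = m"
    using range(1)[OF i(1)] by (cases "i = 1") auto
  have "1 - int m \<notin> S"
    using range(1) by (force simp: S_def diagonal_def)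
  then have "1 - int m \<in> S'" using fill m by force
  then obtain i' where i': "i' \<in> {1..m}" "int (A' i') - int i' = 1 - int m"
    by (auto simp: S'_def diagonal_def)
  then have corner': "A' m = 1"
    using range(2)[OF i'(1)] by (cases "i' = m") auto
  have "2 - int m \<notin> S"
  proof
    assume "2 - int m \<in> S"
    then obtain k where k: "k \<in> {1..m}" "int (A k) - int k + 1 = 2 - int m"
      by (auto simp: S_def diagonal_def)
    then have "A m = 1"
      using range(1)[OF k(1)] by (cases "k = m") auto
    moreover have "\<bar>int 1 - int m\<bar> \<noteq> \<bar>int (A 1) - int (A m)\<bar>"
      using A[unfolded queens_solution_def, THEN conjunct2, rule_format, of 1 m] m by simp
    ultimately show False using corner m by simp
  qed
  then have "2 - int m \<in> S'" using fill m by force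
  then obtain k where k: "k \<in> {1..m}" "int (A' k) - int k = 2 - int m"
    by (auto simp: S'_def diagonal_def)
  have "k \<noteq> m" using k corner' by auto
  then have "A' k = A' m"
    using k range(2)[OF k(1)] corner' by auto
  moreover have "inj_on A' {1..m}"
    using A' by (auto simp: queens_solution_def bij_betw_def)
  ultimately show False
    using \<open>k \<noteq> m\<close> k(1) m inj_onD[of A' "{1..m}" k m] by simp
qed

lemma shifted_diagonals_meet:
  assumes m: "2 \<le> m" and s: "s \<in> {1, -1}"
    and A: "queens_solution m A" and A': "queens_solution m A'"
  shows "\<exists>i\<in>{1..m}. \<exists>i'\<in>{1..m}. diagonal s A i + 1 = diagonal s A' i'"
proof (cases "s = 1")
  case True
  then show ?thesis using shifted_main_diagonals_meet[OF m A A'] by simp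
next
  case False
  with s have s: "s = -1" by simp
  \<comment> \<open>The mirror image also reverses the order of the diagonals, so \<open>A\<close> and \<open>A'\<close> swap roles.\<close>
  obtain i' i where i: "i' \<in> {1..m}" "i \<in> {1..m}"
    and eq: "diagonal 1 (\<lambda>i. m + 1 - A' i) i' + 1 = diagonal 1 (\<lambda>i. m + 1 - A i) i"
    using shifted_main_diagonals_meet[OF m queens_solution_mirror[OF A'] queens_solution_mirror[OF A]]
    by blast
  have "diagonal s A i + 1 = diagonal s A' i'"
    using eq queens_solution_range[OF A i(2)] queens_solution_range[OF A' i(1)]
    by (auto simp: diagonal_def s)
  with i show ?thesis by blast
qed

section \<open>Block coordinates\<close>

definition block_pos :: "nat \<Rightarrow> nat \<times> nat \<Rightarrow> nat" where
  "block_pos n = (\<lambda>(i, j). n * (i - 1) + j)"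

lemma bij_betw_block_pos: "bij_betw (block_pos n) ({1..m} \<times> {1..n}) {1..m * n}"
proof (rule bij_betwI[where g = "\<lambda>k. ((k - 1) div n + 1, (k - 1) mod n + 1)"])
  show "block_pos n \<in> {1..m} \<times> {1..n} \<rightarrow> {1..m * n}"
  proof
    fix p assume "p \<in> {1..m} \<times> {1..n}"
    then obtain i j where p: "p = (Suc i, j)" "i < m" "1 \<le> j" "j \<le> n"
      by (cases p; cases "fst p") auto
    have "n * i + j \<le> n * Suc i" using p by simp
    also have "\<dots> \<le> n * m" using p by (intro mult_le_mono2) simp
    finally show "block_pos n p \<in> {1..m * n}" using p by (simp add: block_pos_def mult.commute)
  qed
  show "(\<lambda>k. ((k - 1) div n + 1, (k - 1) mod n + 1)) \<in> {1..m * n} \<rightarrow> {1..m} \<times> {1..n}"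
  proof
    fix k assume k: "k \<in> {1..m * n}"
    then have "0 < n" by (cases n) auto
    moreover have "(k - 1) div n < m" using k by (intro less_mult_imp_div_less) auto
    ultimately show "((k - 1) div n + 1, (k - 1) mod n + 1) \<in> {1..m} \<times> {1..n}"
      by (simp add: Suc_le_eq)
  qed
  show "((block_pos n p - 1) div n + 1, (block_pos n p - 1) mod n + 1) = p"
    if "p \<in> {1..m} \<times> {1..n}" for p
  proof -
    from that obtain i j where "p = (Suc i, Suc j)" "j < n"
      by (cases p; cases "fst p"; cases "snd p") auto
    then show ?thesis by (simp add: block_pos_def)
  qed
  show "block_pos n ((k - 1) div n + 1, (k - 1) mod n + 1) = k" if "k \<in> {1..m * n}" for k
    using that by (simp add: block_pos_def)
qed

lemma of_nat_block_pos:
  "1 \<le> i \<Longrightarrow> int (block_pos n (i, j)) = int n * (int i - 1) + int j"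
  by (simp add: block_pos_def of_nat_diff)

lemma gen_comp_block_pos:
  assumes "i \<in> {1..m}" "j \<in> {1..n}"
  shows "gen_comp n A B (block_pos n (i, j)) = block_pos n (A j i, B j)"
  using gen_comp_eq[of i j n A B] assms by (simp add: block_pos_def)

lemma bij_betw_gen_comp:
  assumes B: "bij_betw B {1..n} {1..n}"
    and A: "\<And>j. j \<in> {1..n} \<Longrightarrow> bij_betw (A j) {1..m} {1..m}"
  shows "bij_betw (gen_comp n A B) {1..m * n} {1..m * n}"
proof -
  let ?G = "{1..m} \<times> {1..n}"
  let ?f = "\<lambda>(i, j). (A j i, B j)"
  have "inj_on ?f ?G"
  proof (rule inj_onI)
    fix p q assume "p \<in> ?G" "q \<in> ?G" and eq: "?f p = ?f q"
    then obtain i j i' j' where pq: "p = (i, j)" "q = (i', j')"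
      and ij: "i \<in> {1..m}" "j \<in> {1..n}" "i' \<in> {1..m}" "j' \<in> {1..n}" by blast
    with eq B have j: "j = j'" by (auto simp: bij_betw_def dest: inj_onD)
    with eq pq have "A j i = A j i'" by simp
    with A[OF ij(2)] ij have "i = i'" by (auto simp: bij_betw_def dest: inj_onD)
    with j pq show "p = q" by simp
  qed
  moreover have "?f ` ?G \<subseteq> ?G"
    using A[THEN bij_betwE] bij_betwE[OF B] by fastforce
  ultimately have "bij_betw ?f ?G ?G"
    by (simp add: bij_betw_def endo_inj_surj)
  then have "bij_betw (block_pos n \<circ> ?f) ?G {1..m * n}"
    using bij_betw_block_pos by (rule bij_betw_trans)
  also have "?this \<longleftrightarrow> bij_betw (gen_comp n A B \<circ> block_pos n) ?G {1..m * n}"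
    by (intro bij_betw_cong) (auto simp: gen_comp_block_pos)
  finally show ?thesis
    using bij_betw_comp_iff[OF bij_betw_block_pos] by blast
qed

text \<open>The offset \<open>s - 1\<close> arises because blocks and their values are numbered from \<open>1\<close>; it
  does not depend on the queen, so it cancels whenever two diagonals are compared.\<close>

lemma diagonal_gen_comp:
  assumes "i \<in> {1..m}" "j \<in> {1..n}" "A j i \<in> {1..m}"
  shows "diagonal s (gen_comp n A B) (block_pos n (i, j)) =
    int n * (diagonal s (A j) i + s - 1) + diagonal s B j"
  using assms unfolding diagonal_def gen_comp_block_pos[OF assms(1,2)]
  by (simp add: of_nat_block_pos algebra_simps)

section \<open>Diagonals of the composition\<close>

lemma inj_diagonal_gen_comp_iff:
  assumes m: "2 \<le> m" and s: "s \<in> {1, -1}" and B: "queens_solution n B"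
    and A: "\<And>j. j \<in> {1..n} \<Longrightarrow> queens_solution m (A j)"
  shows "inj_on (diagonal s (gen_comp n A B)) {1..m * n} \<longleftrightarrow>
    inj_on (\<lambda>j. diagonal s B j mod int n) {1..n}"
proof -
  let ?G = "{1..m} \<times> {1..n}"
  let ?d = "\<lambda>p. diagonal s (gen_comp n A B) (block_pos n p)"
  have d: "?d (i, j) = int n * (diagonal s (A j) i + s - 1) + diagonal s B j"
    if "i \<in> {1..m}" "j \<in> {1..n}" for i j
    using that queens_solution_range[OF A] by (intro diagonal_gen_comp) auto
  have coords: "inj_on (diagonal s (gen_comp n A B)) {1..m * n} \<longleftrightarrow> inj_on ?d ?G"
    using bij_betw_block_pos[of n m] comp_inj_on_iff[of "block_pos n" ?G]
    by (simp add: bij_betw_def comp_def)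
  show ?thesis
    unfolding coords
  proof
    assume R: "inj_on (\<lambda>j. diagonal s B j mod int n) {1..n}"
    show "inj_on ?d ?G"
    proof (rule inj_onI)
      fix p q assume "p \<in> ?G" "q \<in> ?G" and eq: "?d p = ?d q"
      then obtain i j i' j' where pq: "p = (i, j)" "q = (i', j')"
        and ij: "i \<in> {1..m}" "j \<in> {1..n}" "i' \<in> {1..m}" "j' \<in> {1..n}" by blast
      note eq = eq[unfolded pq d[OF ij(1,2)] d[OF ij(3,4)]]
      then have "diagonal s B j mod int n = diagonal s B j' mod int n"
        by (metis mod_mult_self4)
      with R ij have j: "j = j'" by (auto dest: inj_onD)
      with eq ij have "diagonal s (A j) i = diagonal s (A j) i'" by simp
      moreover have "inj_on (diagonal s (A j)) {1..m}"
        using A[OF ij(2)] s by (auto simp: queens_solution_iff_inj_diagonals)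
      ultimately show "p = q" using ij j pq by (auto dest: inj_onD)
    qed
  next
    assume L: "inj_on ?d ?G"
    \<comment> \<open>A gap of \<open>n\<close> between diagonals of \<open>B\<close> is a shift by \<open>1\<close> at the level of blocks.\<close>
    have gap: "diagonal s B j \<noteq> diagonal s B j' + int n"
      if j: "j \<in> {1..n}" "j' \<in> {1..n}" for j j'
    proof
      assume eq: "diagonal s B j = diagonal s B j' + int n"
      obtain i i' where i: "i \<in> {1..m}" "i' \<in> {1..m}"
        and meet: "diagonal s (A j) i + 1 = diagonal s (A j') i'"
        using shifted_diagonals_meet[OF m s A[OF j(1)] A[OF j(2)]] by blast
      have "?d (i, j) = ?d (i', j')"
        unfolding d[OF i(1) j(1)] d[OF i(2) j(2)] meet[symmetric] eq
        by (simp add: algebra_simps)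
      with L i j have "j = j'" by (auto dest: inj_onD)
      with eq j show False by simp
    qed
    show "inj_on (\<lambda>j. diagonal s B j mod int n) {1..n}"
    proof (rule inj_onI)
      fix j j' assume j: "j \<in> {1..n}" "j' \<in> {1..n}"
        and "diagonal s B j mod int n = diagonal s B j' mod int n"
      then have "int n dvd diagonal s B j - diagonal s B j'"
        by (simp add: mod_eq_dvd_iff)
      then obtain t where t: "diagonal s B j - diagonal s B j' = int n * t" ..
      have "\<bar>diagonal s B j - diagonal s B j'\<bar> < int n * 2"
        using s j queens_solution_range[OF B j(1)] queens_solution_range[OF B j(2)]
        by (auto simp: diagonal_def)
      then have "int n * \<bar>t\<bar> < int n * 2" by (simp add: t abs_mult)
      then have "\<bar>t\<bar> < 2" by (simp add: mult_less_cancel_left)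
      moreover have "t \<noteq> 1" using gap[OF j] t by auto
      moreover have "t \<noteq> -1" using gap[OF j(2) j(1)] t by auto
      ultimately have "t = 0" by linarith
      with t have "diagonal s B j = diagonal s B j'" by simp
      moreover have "inj_on (diagonal s B) {1..n}"
        using B s by (auto simp: queens_solution_iff_inj_diagonals)
      ultimately show "j = j'" using j by (auto dest: inj_onD)
    qed
  qed
qed

lemma image_mod_eq_residues_iff_inj:
  fixes f :: "nat \<Rightarrow> int"
  shows "(\<lambda>i. f i mod int n) ` {1..n} = carrier (residue_ring (int n)) \<longleftrightarrow>
    inj_on (\<lambda>i. f i mod int n) {1..n}" (is "?g ` _ = _ \<longleftrightarrow> _")
proof -
  have carrier: "carrier (residue_ring (int n)) = {0..int n - 1}"
    by (simp add: residue_ring_def)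
  have sub: "?g ` {1..n} \<subseteq> {0..int n - 1}" by auto
  have "?g ` {1..n} = {0..int n - 1} \<longleftrightarrow> card (?g ` {1..n}) = card {0..int n - 1}"
    using card_subset_eq[OF _ sub] by auto
  also have "\<dots> \<longleftrightarrow> inj_on ?g {1..n}"
    using inj_on_iff_eq_card[of "{1..n}" ?g] by simp
  finally show ?thesis by (simp add: carrier)
qed

theorem theorem2p3:
  fixes m n :: nat and A :: "nat \<Rightarrow> nat \<Rightarrow> nat" and B :: "nat \<Rightarrow> nat"
  assumes "2 \<le> m"
    and "queens_solution n B"
    and "\<And>j. 1 \<le> j \<Longrightarrow> j \<le> n \<Longrightarrow> queens_solution m (A j)"
  shows "queens_solution (m * n) (gen_comp n A B) \<longleftrightarrow>
    {(int (B i) - int i) mod int n | i. 1 \<le> i \<and> i \<le> n} = carrier (residue_ring (int n)) \<and>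
    {(int (B i) + int i) mod int n | i. 1 \<le> i \<and> i \<le> n} = carrier (residue_ring (int n))"
proof -
  have A: "queens_solution m (A j)" if "j \<in> {1..n}" for j
    using assms(3) that by simp
  have "bij_betw (gen_comp n A B) {1..m * n} {1..m * n}"
    using assms(2) A by (intro bij_betw_gen_comp) (auto simp: queens_solution_def)
  then have "queens_solution (m * n) (gen_comp n A B) \<longleftrightarrow>
      (\<forall>s\<in>{1, -1}. inj_on (diagonal s (gen_comp n A B)) {1..m * n})"
    by (simp add: queens_solution_iff_inj_diagonals)
  also have "\<dots> \<longleftrightarrow> (\<forall>s\<in>{1, -1}. inj_on (\<lambda>j. diagonal s B j mod int n) {1..n})"
    using inj_diagonal_gen_comp_iff[OF assms(1) _ assms(2) A] by (intro ball_cong) auto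
  also have "\<dots> \<longleftrightarrow> (\<forall>s\<in>{1, -1}.
      (\<lambda>j. diagonal s B j mod int n) ` {1..n} = carrier (residue_ring (int n)))"
    by (simp only: image_mod_eq_residues_iff_inj)
  also have "\<dots> \<longleftrightarrow> (\<forall>s\<in>{1, -1}.
      {(int (B i) - s * int i) mod int n | i. 1 \<le> i \<and> i \<le> n} = carrier (residue_ring (int n)))"
  proof -
    have "(\<lambda>j. diagonal s B j mod int n) ` {1..n} =
        {(int (B i) - s * int i) mod int n | i. 1 \<le> i \<and> i \<le> n}" for s
      by (auto simp: diagonal_def)
    then show ?thesis by simp
  qed
  finally show ?thesis by simp
qed

end
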